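(* Let $K$ be a field and $A,M$ two $K$-vector spaces with two commuting linear maps $\alpha_A,\beta_A:A\to A$, two commuting linear maps $\alpha_M,\beta_M:M\to M$, and four linear maps $\mu_A:A\otimes A\to A$, $a\otimes b\mapsto ab$; $\mu_M:M\otimes M\to M$, $m\otimes n\mapsto mn$; $\triangleright:A\otimes M\to M$, $a\otimes m\mapsto a\triangleright m$; $\triangleleft:M\otimes A\to M$, $m\otimes a\mapsto m\triangleleft a$. Define a binary operation $\mu_{A\oplus M}$ on $A\oplus M$ by $$(a+m)(b+n)=ab+a\triangleright n+m\triangleleft b+mn,\qquad a,b\in A,\ m,n\in M.$$ Then $(A\oplus M,\mu_{A\oplus M},\alpha_A\oplus\alpha_M,\beta_A\oplus\beta_M)$ is a BiHom-associative algebra if and only if (a) $(A,\mu_A,\alpha_A,\beta_A)$ is a BiHom-associative algebra; and (b) $(M,\mu_M,\triangleright,\triangleleft,\alpha_M,\beta_M)$ is a BiHom-bimodule algebra over $(A,\mu_A,\alpha_A,\beta_A)$.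
   Context: $(f\oplus g)(a+m)=f(a)+g(m)$. BiHom-associative algebra $(A,\mu,\alpha,\beta)$: linear $\mu$ (written $ab$), $\alpha,\beta:A\to A$ with $\alpha\beta=\beta\alpha$, $\alpha(ab)=\alpha(a)\alpha(b)$, $\beta(ab)=\beta(a)\beta(b)$, $\alpha(a)(bc)=(ab)\beta(c)$. No unit is assumed. Bimodule $(M,\triangleright,\triangleleft,\alpha_M,\beta_M)$ over it: $\alpha_M\beta_M=\beta_M\alpha_M$; $f_M(a\triangleright m)=f_A(a)\triangleright f_M(m)$, $f_M(m\triangleleft a)=f_M(m)\triangleleft f_A(a)$ for $f\in\{\alpha,\beta\}$; $\alpha_A(a)\triangleright(a'\triangleright m)=(aa')\triangleright\beta_M(m)$; $\alpha_M(m)\triangleleft(aa')=(m\triangleleft a)\triangleleft\beta_A(a')$; $\alpha_A(a)\triangleright(m\triangleleft a')=(a\triangleright m)\triangleleft\beta_A(a')$. BiHom-bimodule algebra $(M,\mu_M,\triangleright,\triangleleft,\alpha_M,\beta_M)$: a bimodule such that $(M,\mu_M,\alpha_M,\beta_M)$ is a BiHom-associative algebra and $\alpha_A(a)\triangleright(mn)=(a\triangleright m)\beta_M(n)$, $\alpha_M(m)(n\triangleleft a)=(mn)\triangleleft\beta_A(a)$, $\alpha_M(m)(a\triangleright n)=(m\triangleleft a)\beta_M(n)$ for all $a\in A$, $m,n\in M$. *)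

theory Defs
  imports "HOL-Analysis.Product_Vector"
begin

text \<open>
  A linear map out of a tensor product \<open>V \<otimes> W\<close> is given by the corresponding bilinear map on
  \<open>V\<close> and \<open>W\<close>; all multiplications and actions below are curried bilinear maps.
\<close>

definition bilinear_over ::
    "('k::field \<Rightarrow> 'v::ab_group_add \<Rightarrow> 'v) \<Rightarrow> ('k \<Rightarrow> 'w::ab_group_add \<Rightarrow> 'w) \<Rightarrow>
     ('k \<Rightarrow> 'u::ab_group_add \<Rightarrow> 'u) \<Rightarrow> ('v \<Rightarrow> 'w \<Rightarrow> 'u) \<Rightarrow> bool"
  where "bilinear_over sV sW sU f \<longleftrightarrow>
    (\<forall>v. Vector_Spaces.linear sW sU (\<lambda>w. f v w)) \<and>
    (\<forall>w. Vector_Spaces.linear sV sU (\<lambda>v. f v w))"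

locale bihom_associative_algebra = vector_space scale
  for scale :: "'k::field \<Rightarrow> 'a::ab_group_add \<Rightarrow> 'a" +
  fixes mult :: "'a \<Rightarrow> 'a \<Rightarrow> 'a" (infixl "\<cdot>" 70)
    and \<alpha> :: "'a \<Rightarrow> 'a"
    and \<beta> :: "'a \<Rightarrow> 'a"
  assumes mult_bilinear: "bilinear_over scale scale scale (\<cdot>)"
    and alpha_linear: "Vector_Spaces.linear scale scale \<alpha>"
    and beta_linear: "Vector_Spaces.linear scale scale \<beta>"
    and alpha_beta_commute: "\<alpha> \<circ> \<beta> = \<beta> \<circ> \<alpha>"
    and alpha_mult: "\<alpha> (a \<cdot> b) = \<alpha> a \<cdot> \<alpha> b"
    and beta_mult: "\<beta> (a \<cdot> b) = \<beta> a \<cdot> \<beta> b"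
    and bihom_assoc: "\<alpha> a \<cdot> (b \<cdot> c) = (a \<cdot> b) \<cdot> \<beta> c"

locale bihom_bimodule =
  A: bihom_associative_algebra scaleA multA \<alpha>A \<beta>A + M: vector_space scaleM
  for scaleA :: "'k::field \<Rightarrow> 'a::ab_group_add \<Rightarrow> 'a"
    and multA :: "'a \<Rightarrow> 'a \<Rightarrow> 'a" (infixl "\<cdot>" 70)
    and \<alpha>A :: "'a \<Rightarrow> 'a"
    and \<beta>A :: "'a \<Rightarrow> 'a"
    and scaleM :: "'k \<Rightarrow> 'm::ab_group_add \<Rightarrow> 'm" +
  fixes left_act :: "'a \<Rightarrow> 'm \<Rightarrow> 'm" (infixl "\<triangleright>" 70)
    and right_act :: "'m \<Rightarrow> 'a \<Rightarrow> 'm" (infixl "\<triangleleft>" 70)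
    and \<alpha>M :: "'m \<Rightarrow> 'm"
    and \<beta>M :: "'m \<Rightarrow> 'm"
  assumes left_act_bilinear: "bilinear_over scaleA scaleM scaleM (\<triangleright>)"
    and right_act_bilinear: "bilinear_over scaleM scaleA scaleM (\<triangleleft>)"
    and alphaM_linear: "Vector_Spaces.linear scaleM scaleM \<alpha>M"
    and betaM_linear: "Vector_Spaces.linear scaleM scaleM \<beta>M"
    and alphaM_betaM_commute: "\<alpha>M \<circ> \<beta>M = \<beta>M \<circ> \<alpha>M"
    and alpha_left_act: "\<alpha>M (a \<triangleright> m) = \<alpha>A a \<triangleright> \<alpha>M m"
    and beta_left_act: "\<beta>M (a \<triangleright> m) = \<beta>A a \<triangleright> \<beta>M m"
    and alpha_right_act: "\<alpha>M (m \<triangleleft> a) = \<alpha>M m \<triangleleft> \<alpha>A a"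
    and beta_right_act: "\<beta>M (m \<triangleleft> a) = \<beta>M m \<triangleleft> \<beta>A a"
    and left_act_assoc: "\<alpha>A a \<triangleright> (a' \<triangleright> m) = (a \<cdot> a') \<triangleright> \<beta>M m"
    and right_act_assoc: "\<alpha>M m \<triangleleft> (a \<cdot> a') = (m \<triangleleft> a) \<triangleleft> \<beta>A a'"
    and left_right_act_assoc: "\<alpha>A a \<triangleright> (m \<triangleleft> a') = (a \<triangleright> m) \<triangleleft> \<beta>A a'"

locale bihom_bimodule_algebra =
  bihom_bimodule scaleA multA \<alpha>A \<beta>A scaleM left_act right_act \<alpha>M \<beta>M +
  M: bihom_associative_algebra scaleM multM \<alpha>M \<beta>M
  for scaleA :: "'k::field \<Rightarrow> 'a::ab_group_add \<Rightarrow> 'a"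
    and multA :: "'a \<Rightarrow> 'a \<Rightarrow> 'a" (infixl "\<cdot>" 70)
    and \<alpha>A :: "'a \<Rightarrow> 'a"
    and \<beta>A :: "'a \<Rightarrow> 'a"
    and scaleM :: "'k \<Rightarrow> 'm::ab_group_add \<Rightarrow> 'm"
    and multM :: "'m \<Rightarrow> 'm \<Rightarrow> 'm" (infixl "\<odot>" 70)
    and left_act :: "'a \<Rightarrow> 'm \<Rightarrow> 'm" (infixl "\<triangleright>" 70)
    and right_act :: "'m \<Rightarrow> 'a \<Rightarrow> 'm" (infixl "\<triangleleft>" 70)
    and \<alpha>M :: "'m \<Rightarrow> 'm"
    and \<beta>M :: "'m \<Rightarrow> 'm" +
  assumes left_act_mult: "\<alpha>A a \<triangleright> (m \<odot> n) = (a \<triangleright> m) \<odot> \<beta>M n"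
    and mult_right_act: "\<alpha>M m \<odot> (n \<triangleleft> a) = (m \<odot> n) \<triangleleft> \<beta>A a"
    and mult_left_act: "\<alpha>M m \<odot> (a \<triangleright> n) = (m \<triangleleft> a) \<odot> \<beta>M n"

text \<open>
  The direct sum \<open>A \<oplus> M\<close> is the product type, with \<open>a + m\<close> encoded as \<open>(a, m)\<close>, scalar
  multiplication \<^const>\<open>module_prod.scale\<close>, and \<open>f \<oplus> g\<close> given by \<^const>\<open>map_prod\<close>.
\<close>

definition direct_sum_mult ::
    "('a::ab_group_add \<Rightarrow> 'a \<Rightarrow> 'a) \<Rightarrow> ('m::ab_group_add \<Rightarrow> 'm \<Rightarrow> 'm) \<Rightarrow>
     ('a \<Rightarrow> 'm \<Rightarrow> 'm) \<Rightarrow> ('m \<Rightarrow> 'a \<Rightarrow> 'm) \<Rightarrow> 'a \<times> 'm \<Rightarrow> 'a \<times> 'm \<Rightarrow> 'a \<times> 'm"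
  where "direct_sum_mult multA multM left_act right_act =
    (\<lambda>(a, m) (b, n). (multA a b, left_act a n + right_act m b + multM m n))"

end

theory Submission
  imports Defs
begin

text \<open>
  Both sides contain the same linearity conditions, so only the multiplicative identities matter.
  By bilinearity, each identity for \<open>A \<oplus> M\<close> holds for all arguments iff it holds whenever every
  argument lies in one of the two summands; the resulting special cases are exactly the axioms
  of a BiHom-associative algebra and of a BiHom-bimodule algebra.
\<close>

lemma bilinear_over_iff:
  "bilinear_over sV sW sU f \<longleftrightarrow>
     vector_space sV \<and> vector_space sW \<and> vector_space sU \<and>
     (\<forall>v w w'. f v (w + w') = f v w + f v w') \<and> (\<forall>v v' w. f (v + v') w = f v w + f v' w) \<and>
     (\<forall>c v w. f v (sW c w) = sU c (f v w)) \<and> (\<forall>c v w. f (sV c v) w = sU c (f v w))"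
  unfolding bilinear_over_def Vector_Spaces.linear_iff by auto

lemma bilinear_over_zero:
  assumes "bilinear_over sV sW sU f"
  shows "f v 0 = 0" "f 0 w = 0"
proof -
  have "f v (0 + 0) = f v 0 + f v 0" "f (0 + 0) w = f 0 w + f 0 w"
    using assms unfolding bilinear_over_iff by blast+
  then show "f v 0 = 0" "f 0 w = 0" by simp_all
qed

context vector_space_prod
begin

lemma linear_map_prod:
  assumes "Vector_Spaces.linear s1 s1 f" "Vector_Spaces.linear s2 s2 g"
  shows "Vector_Spaces.linear scale scale (map_prod f g)"
  using assms p.vector_space_axioms
  by (auto simp: Vector_Spaces.linear_iff scale_def)

lemma bilinear_direct_sum_mult:
  assumes "bilinear_over s1 s1 s1 multA" "bilinear_over s2 s2 s2 multM"
    and "bilinear_over s1 s2 s2 left_act" "bilinear_over s2 s1 s2 right_act"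
  shows "bilinear_over scale scale scale (direct_sum_mult multA multM left_act right_act)"
  using assms p.vector_space_axioms
  by (auto simp: bilinear_over_iff direct_sum_mult_def scale_def vs2.scale_right_distrib)

end

theorem lemma2p11:
  fixes scaleA :: "'k::field \<Rightarrow> 'a::ab_group_add \<Rightarrow> 'a"
    and scaleM :: "'k \<Rightarrow> 'm::ab_group_add \<Rightarrow> 'm"
    and \<alpha>A \<beta>A :: "'a \<Rightarrow> 'a"
    and \<alpha>M \<beta>M :: "'m \<Rightarrow> 'm"
    and multA :: "'a \<Rightarrow> 'a \<Rightarrow> 'a"
    and multM :: "'m \<Rightarrow> 'm \<Rightarrow> 'm"
    and left_act :: "'a \<Rightarrow> 'm \<Rightarrow> 'm"
    and right_act :: "'m \<Rightarrow> 'a \<Rightarrow> 'm"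
  assumes "vector_space scaleA" and "vector_space scaleM"
    and "Vector_Spaces.linear scaleA scaleA \<alpha>A" and "Vector_Spaces.linear scaleA scaleA \<beta>A"
    and "\<alpha>A \<circ> \<beta>A = \<beta>A \<circ> \<alpha>A"
    and "Vector_Spaces.linear scaleM scaleM \<alpha>M" and "Vector_Spaces.linear scaleM scaleM \<beta>M"
    and "\<alpha>M \<circ> \<beta>M = \<beta>M \<circ> \<alpha>M"
    and "bilinear_over scaleA scaleA scaleA multA"
    and "bilinear_over scaleM scaleM scaleM multM"
    and "bilinear_over scaleA scaleM scaleM left_act"
    and "bilinear_over scaleM scaleA scaleM right_act"
  shows "bihom_associative_algebra (module_prod.scale scaleA scaleM)
           (direct_sum_mult multA multM left_act right_act)
           (map_prod \<alpha>A \<alpha>M) (map_prod \<beta>A \<beta>M) \<longleftrightarrow>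
         bihom_associative_algebra scaleA multA \<alpha>A \<beta>A \<and>
         bihom_bimodule_algebra scaleA multA \<alpha>A \<beta>A scaleM multM left_act right_act \<alpha>M \<beta>M"
proof -
  interpret A: vector_space scaleA by fact
  interpret M: vector_space scaleM by fact
  interpret P: vector_space_prod scaleA scaleM ..
  let ?mult = "direct_sum_mult multA multM left_act right_act"
  let ?\<alpha> = "map_prod \<alpha>A \<alpha>M" and ?\<beta> = "map_prod \<beta>A \<beta>M"
  note zero = assms(3,4,6,7)[unfolded linear_iff_module_hom, THEN module_hom.zero]
    assms(9-12)[THEN bilinear_over_zero(1)]
    assms(9-12)[THEN bilinear_over_zero(2)]
  have add: "\<And>m n. \<alpha>M (m + n) = \<alpha>M m + \<alpha>M n" "\<And>m n. \<beta>M (m + n) = \<beta>M m + \<beta>M n"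
    "\<And>m n p. multM m (n + p) = multM m n + multM m p"
    "\<And>m n p. multM (m + n) p = multM m p + multM n p"
    "\<And>a m n. left_act a (m + n) = left_act a m + left_act a n"
    "\<And>a m n. right_act (m + n) a = right_act m a + right_act n a"
    using assms(6,7,10-12) by (simp_all add: Vector_Spaces.linear_iff bilinear_over_iff)
  note mult = direct_sum_mult_def
  show ?thesis
  proof
    assume "bihom_associative_algebra P.scale ?mult ?\<alpha> ?\<beta>"
    then interpret S: bihom_associative_algebra P.scale ?mult ?\<alpha> ?\<beta> .
    have A: "bihom_associative_algebra scaleA multA \<alpha>A \<beta>A"
      using S.alpha_mult[of "(_, 0)" "(_, 0)"] S.beta_mult[of "(_, 0)" "(_, 0)"]
        S.bihom_assoc[of "(_, 0)" "(_, 0)" "(_, 0)"]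
      by (intro bihom_associative_algebra.intro bihom_associative_algebra_axioms.intro)
        (simp_all add: assms mult zero)
    have M: "bihom_associative_algebra scaleM multM \<alpha>M \<beta>M"
      using S.alpha_mult[of "(0, _)" "(0, _)"] S.beta_mult[of "(0, _)" "(0, _)"]
        S.bihom_assoc[of "(0, _)" "(0, _)" "(0, _)"]
      by (intro bihom_associative_algebra.intro bihom_associative_algebra_axioms.intro)
        (simp_all add: assms mult zero)
    have "bihom_bimodule_algebra scaleA multA \<alpha>A \<beta>A scaleM multM left_act right_act \<alpha>M \<beta>M"
      using S.alpha_mult[of "(_, 0)" "(0, _)"] S.beta_mult[of "(_, 0)" "(0, _)"]
        S.alpha_mult[of "(0, _)" "(_, 0)"] S.beta_mult[of "(0, _)" "(_, 0)"]
        S.bihom_assoc[of "(_, 0)" "(_, 0)" "(0, _)"]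
        S.bihom_assoc[of "(0, _)" "(_, 0)" "(_, 0)"]
        S.bihom_assoc[of "(_, 0)" "(0, _)" "(_, 0)"]
        S.bihom_assoc[of "(_, 0)" "(0, _)" "(0, _)"]
        S.bihom_assoc[of "(0, _)" "(0, _)" "(_, 0)"]
        S.bihom_assoc[of "(0, _)" "(_, 0)" "(0, _)"]
      by (intro bihom_bimodule_algebra.intro bihom_bimodule_algebra_axioms.intro
          bihom_bimodule.intro bihom_bimodule_axioms.intro A M)
        (simp_all add: assms mult zero)
    with A show "bihom_associative_algebra scaleA multA \<alpha>A \<beta>A \<and>
        bihom_bimodule_algebra scaleA multA \<alpha>A \<beta>A scaleM multM left_act right_act \<alpha>M \<beta>M" ..
  next
    assume "bihom_associative_algebra scaleA multA \<alpha>A \<beta>A \<and>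
        bihom_bimodule_algebra scaleA multA \<alpha>A \<beta>A scaleM multM left_act right_act \<alpha>M \<beta>M"
    then interpret B: bihom_bimodule_algebra scaleA multA \<alpha>A \<beta>A scaleM multM left_act right_act
      \<alpha>M \<beta>M by blast
    show "bihom_associative_algebra P.scale ?mult ?\<alpha> ?\<beta>"
    proof (intro bihom_associative_algebra.intro bihom_associative_algebra_axioms.intro)
      show "vector_space P.scale" ..
      show "bilinear_over P.scale P.scale P.scale ?mult"
        by (intro P.bilinear_direct_sum_mult assms)
      show "Vector_Spaces.linear P.scale P.scale ?\<alpha>" "Vector_Spaces.linear P.scale P.scale ?\<beta>"
        by (intro P.linear_map_prod assms)+
      show "?\<alpha> \<circ> ?\<beta> = ?\<beta> \<circ> ?\<alpha>"
        by (simp add: map_prod_compose[symmetric] assms)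
      show "?\<alpha> (?mult x y) = ?mult (?\<alpha> x) (?\<alpha> y)" "?\<beta> (?mult x y) = ?mult (?\<beta> x) (?\<beta> y)" for x y
        by (simp_all add: mult split_beta add B.A.alpha_mult B.A.beta_mult B.M.alpha_mult
            B.M.beta_mult B.alpha_left_act B.alpha_right_act B.beta_left_act B.beta_right_act)
      show "?mult (?\<alpha> x) (?mult y z) = ?mult (?mult x y) (?\<beta> z)" for x y z
        by (simp add: mult split_beta add B.A.bihom_assoc B.M.bihom_assoc B.left_act_assoc
            B.right_act_assoc B.left_right_act_assoc B.left_act_mult B.mult_right_act
            B.mult_left_act add_ac)
    qed
  qed
qed

end
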